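(* Let $K$, $U$, $\Gamma$, $u_1,\dots,u_n$ be as in the context. Let $M=Ux$ be a cyclic $U$-module generated by an element $x$ such that $\operatorname{ann}_\Gamma(x)=\mathbf p$ is a prime ideal of $\Gamma$, and suppose that all ideals in $\operatorname{Ass}(M)$ have the same coheight. If $\mathbf q\in\operatorname{Ass}(M)$, then there are a sequence $\mathbf q=\mathbf q_0,\mathbf q_1,\dots,\mathbf q_s=\mathbf p$ of prime ideals of $\Gamma$ with coheight equal to the coheight of $\mathbf p$ and a sequence of indices $k_1,\dots,k_s\in\{1,\dots,n\}$ such that $$\frac{\Gamma u_{k_i}\Gamma}{\mathbf q_{i-1}u_{k_i}\Gamma+\Gamma u_{k_i}\mathbf q_i}\neq 0\quad\text{for all } i=1,\dots,s.$$
   Context: $K$ is an algebraically closed field of characteristic zero. $U$ is a $K$-algebra and $\Gamma\subseteq U$ a commutative $K$-subalgebra such that: (i) $\Gamma$ is finitely generated as a $K$-algebra; (ii) $u_1,\dots,u_n\in U$ are finitely many elements such that $U$ is generated as a $K$-algebra by $\Gamma\cup\{u_1,\dots,u_n\}$; (iii) for every $u\in U$, $\Gamma u\Gamma$ is finitely generated both as a left and as a right $\Gamma$-module. $U$-modules are regarded as $\Gamma$-modules by restriction; $\operatorname{Ass}(M)$ is the set of primes of $\Gamma$ of the form $\operatorname{ann}_\Gamma(y)$, $y\in M$. Coheight: with $Z_0=\operatorname{Specm}\Gamma$ and $Z_i=Z_{i-1}\cup\operatorname{Max}(\operatorname{Spec}\Gamma\setminus Z_{i-1})$ ($\operatorname{Max}$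 = inclusion-maximal elements), the coheight of $\mathbf p$ is the least $i$ with $\mathbf p\in Z_i$. *)

theory Defs
  imports "HOL-Computational_Algebra.Polynomial"
begin

definition alg_closed :: "'k::field itself \<Rightarrow> bool" where
  "alg_closed _ \<longleftrightarrow> (\<forall>p::'k poly. degree p > 0 \<longrightarrow> (\<exists>z. poly p z = 0))"

definition is_K_algebra :: "('k::field \<Rightarrow> 'u::ring_1) \<Rightarrow> bool" where
  "is_K_algebra emb \<longleftrightarrow>
     (\<forall>a b. emb (a + b) = emb a + emb b) \<and>
     (\<forall>a b. emb (a * b) = emb a * emb b) \<and>
     emb 1 = 1 \<and>
     (\<forall>a (v::'u). emb a * v = v * emb a)"

inductive_set subalg_gen :: "('k \<Rightarrow> 'u::ring_1) \<Rightarrow> 'u set \<Rightarrow> 'u set"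
  for emb :: "'k \<Rightarrow> 'u" and S :: "'u set" where
  gen_scalar: "emb c \<in> subalg_gen emb S"
| gen_base: "s \<in> S \<Longrightarrow> s \<in> subalg_gen emb S"
| gen_add: "a \<in> subalg_gen emb S \<Longrightarrow> b \<in> subalg_gen emb S \<Longrightarrow> a + b \<in> subalg_gen emb S"
| gen_mult: "a \<in> subalg_gen emb S \<Longrightarrow> b \<in> subalg_gen emb S \<Longrightarrow> a * b \<in> subalg_gen emb S"

definition comm_subalgebra :: "('k::field \<Rightarrow> 'u::ring_1) \<Rightarrow> 'u set \<Rightarrow> bool" where
  "comm_subalgebra emb G \<longleftrightarrow>
     range emb \<subseteq> G \<and>
     (\<forall>a\<in>G. \<forall>b\<in>G. a + b \<in> G \<and> a * b \<in> G) \<and>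
     (\<forall>a\<in>G. \<forall>b\<in>G. a * b = b * a)"

text \<open>Additive subgroup generated by a set (for the sets considered below this is
  the same as the K-span, since the generating sets are stable under K-scalars).\<close>
inductive_set addspan :: "'u::ab_group_add set \<Rightarrow> 'u set" for S where
  span_zero: "0 \<in> addspan S"
| span_base: "s \<in> S \<Longrightarrow> s \<in> addspan S"
| span_add: "a \<in> addspan S \<Longrightarrow> b \<in> addspan S \<Longrightarrow> a + b \<in> addspan S"
| span_neg: "a \<in> addspan S \<Longrightarrow> - a \<in> addspan S"

definition triple_span :: "'u::ring_1 set \<Rightarrow> 'u \<Rightarrow> 'u set \<Rightarrow> 'u set" where
  "triple_span A v B = addspan {a * v * b | a b. a \<in> A \<and> b \<in> B}"

definition left_span :: "'u::ring_1 set \<Rightarrow> 'u set \<Rightarrow> 'u set" where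
  "left_span G F = addspan {g * f | g f. g \<in> G \<and> f \<in> F}"

definition right_span :: "'u::ring_1 set \<Rightarrow> 'u set \<Rightarrow> 'u set" where
  "right_span G F = addspan {f * g | g f. g \<in> G \<and> f \<in> F}"

definition ideal_in :: "'u::ring_1 set \<Rightarrow> 'u set \<Rightarrow> bool" where
  "ideal_in G I \<longleftrightarrow> I \<subseteq> G \<and> 0 \<in> I \<and>
     (\<forall>a\<in>I. \<forall>b\<in>I. a + b \<in> I) \<and> (\<forall>g\<in>G. \<forall>a\<in>I. g * a \<in> I)"

definition prime_ideal_in :: "'u::ring_1 set \<Rightarrow> 'u set \<Rightarrow> bool" where
  "prime_ideal_in G P \<longleftrightarrow> ideal_in G P \<and> P \<noteq> G \<and>
     (\<forall>a\<in>G. \<forall>b\<in>G. a * b \<in> P \<longrightarrow> a \<in> P \<or> b \<in> P)"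

definition max_ideal_in :: "'u::ring_1 set \<Rightarrow> 'u set \<Rightarrow> bool" where
  "max_ideal_in G P \<longleftrightarrow> ideal_in G P \<and> P \<noteq> G \<and>
     (\<forall>J. ideal_in G J \<and> P \<subseteq> J \<longrightarrow> J = P \<or> J = G)"

definition Spec :: "'u::ring_1 set \<Rightarrow> 'u set set" where
  "Spec G = {P. prime_ideal_in G P}"

definition Specm :: "'u::ring_1 set \<Rightarrow> 'u set set" where
  "Specm G = {P. max_ideal_in G P}"

definition Max_incl :: "'a set set \<Rightarrow> 'a set set" where
  "Max_incl S = {P \<in> S. \<forall>Q\<in>S. P \<subseteq> Q \<longrightarrow> Q = P}"

primrec Zc :: "'u::ring_1 set \<Rightarrow> nat \<Rightarrow> 'u set set" where
  "Zc G 0 = Specm G"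
| "Zc G (Suc i) = Zc G i \<union> Max_incl (Spec G - Zc G i)"

definition coheight :: "'u::ring_1 set \<Rightarrow> 'u set \<Rightarrow> nat" where
  "coheight G P = (LEAST i. P \<in> Zc G i)"

definition is_module :: "('u::ring_1 \<Rightarrow> 'm::ab_group_add \<Rightarrow> 'm) \<Rightarrow> bool" where
  "is_module act \<longleftrightarrow>
     (\<forall>a b m. act (a + b) m = act a m + act b m) \<and>
     (\<forall>a m m'. act a (m + m') = act a m + act a m') \<and>
     (\<forall>a b m. act (a * b) m = act a (act b m)) \<and>
     (\<forall>m. act 1 m = m)"

definition ann_in :: "'u::ring_1 set \<Rightarrow> ('u \<Rightarrow> 'm::ab_group_add \<Rightarrow> 'm) \<Rightarrow> 'm \<Rightarrow> 'u set" where
  "ann_in G act y = {g \<in> G. act g y = 0}"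

definition Ass :: "'u::ring_1 set \<Rightarrow> ('u \<Rightarrow> 'm::ab_group_add \<Rightarrow> 'm) \<Rightarrow> 'u set set" where
  "Ass G act = {P. prime_ideal_in G P \<and> (\<exists>y. P = ann_in G act y)}"

end

theory Submission
  imports Defs
begin

text \<open>Let \<open>R \<subseteq> Ass M\<close> be the set of associated primes joined to \<open>p\<close> by a chain inside \<open>Ass M\<close>,
  and suppose that \<open>q \<in> Ass M\<close> is not in \<open>R\<close>. Then \<open>V = q V + V P\<close> for all \<open>V = \<Gamma> u\<^sub>k \<Gamma>\<close> and
  \<open>P \<in> R\<close>, so if \<open>m\<close> is killed by a product of primes from \<open>R\<close>, then \<open>V m = q V m\<close> and, by
  Nakayama's lemma, \<open>V m\<close> vanishes locally at \<open>q\<close>. In particular no such \<open>q\<close> is associated to \<open>V m\<close>,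
  and over a noetherian ring this makes \<open>V m\<close> itself torsion with respect to \<open>R\<close>. As \<open>x\<close> is killed
  by \<open>p \<in> R\<close>, all of \<open>M\<close> is \<open>R\<close>-torsion; hence each \<open>u\<^sub>k\<close> kills \<open>M\<close> locally at \<open>q\<close>, where \<open>M\<close> is
  therefore just \<open>\<Gamma> x\<close>, whose only associated prime is \<open>p\<close>. All members of the chain lie in
  \<open>Ass M\<close>, which settles their coheights.\<close>

section \<open>Ascending chains of ideals\<close>

text \<open>Rings live on subsets of the noncommutative type \<open>'u\<close>, so commutativity is
  asked only inside \<open>A\<close>. Multiplication by \<open>- 1\<close> supplies additive
  inverses in \<open>A\<close> and in its ideals, since \<open>ideal_in\<close> speaks only of sums
  and multiples.\<close>

locale comm_subring =
  fixes A :: "'u::ring_1 set"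
  assumes one_closed: "1 \<in> A"
    and neg_one_closed: "- 1 \<in> A"
    and add_closed: "a \<in> A \<Longrightarrow> b \<in> A \<Longrightarrow> a + b \<in> A"
    and mult_closed: "a \<in> A \<Longrightarrow> b \<in> A \<Longrightarrow> a * b \<in> A"
    and commute: "a \<in> A \<Longrightarrow> b \<in> A \<Longrightarrow> a * b = b * a"
begin

lemma neg_closed: "a \<in> A \<Longrightarrow> - a \<in> A"
  using mult_closed[OF neg_one_closed] by fastforce

lemma diff_closed: "a \<in> A \<Longrightarrow> b \<in> A \<Longrightarrow> a - b \<in> A"
  using add_closed neg_closed by fastforce

lemma zero_closed: "0 \<in> A"
  using diff_closed[OF one_closed one_closed] by simp

lemma ideal_neg: "ideal_in A I \<Longrightarrow> a \<in> I \<Longrightarrow> - a \<in> I"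
  unfolding ideal_in_def using neg_one_closed by fastforce

lemma ideal_diff: "ideal_in A I \<Longrightarrow> a \<in> I \<Longrightarrow> b \<in> I \<Longrightarrow> a - b \<in> I"
  using ideal_neg[of I b] unfolding ideal_in_def by (metis diff_conv_add_uminus)

lemma prime_one: "prime_ideal_in A P \<Longrightarrow> 1 \<notin> P"
  unfolding prime_ideal_in_def ideal_in_def by (metis mult.right_neutral subsetI subset_antisym)

end

section \<open>Noetherian rings and Hilbert's basis theorem\<close>

definition acc_ideals :: "'u::ring_1 set \<Rightarrow> bool" where
  "acc_ideals A \<longleftrightarrow>
     (\<forall>f. (\<forall>i::nat. ideal_in A (f i)) \<and> mono f \<longrightarrow> (\<exists>N. \<forall>i\<ge>N. f i = f N))"

text \<open>Without a maximal member, dependent choice would build a strictly ascending sequence in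
  \<open>S\<close>.\<close>

lemma acc_ideals_maximal:
  assumes "acc_ideals A" "S \<noteq> {}" "\<And>I. I \<in> S \<Longrightarrow> ideal_in A I"
  shows "\<exists>I\<in>S. \<forall>J\<in>S. I \<subseteq> J \<longrightarrow> J = I"
proof (rule ccontr)
  assume *: "\<not> ?thesis"
  have step: "\<exists>J. J \<in> S \<and> I \<subset> J" if "I \<in> S" for I
    using that * by blast
  have "\<exists>f. \<forall>i. f i \<in> S \<and> f i \<subset> f (Suc i)"
    by (rule dependent_nat_choice) (use assms(2) step in auto)
  then obtain f :: "nat \<Rightarrow> 'a set" where f: "\<And>i. f i \<in> S" "\<And>i. f i \<subset> f (Suc i)" by blast
  have "mono f" using f(2) by (simp add: mono_iff_le_Suc psubset_imp_subset)
  then obtain N where "\<forall>i\<ge>N. f i = f N"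
    using assms(1) f(1) assms(3) unfolding acc_ideals_def by blast
  then show False using f(2)[of N] by (metis le_Suc_eq order_refl psubset_eq)
qed

text \<open>Leading coefficients of polynomial expressions in \<open>t\<close> of formal degree
  \<open>d\<close>. As \<open>t\<close> may be algebraic over \<open>A\<close>, an element of
  \<open>I\<close> can have several expressions; it suffices that one of them starts with
  \<open>c\<close>.\<close>

definition lead_ideal :: "'u::ring_1 set \<Rightarrow> 'u \<Rightarrow> 'u set \<Rightarrow> nat \<Rightarrow> 'u set" where
  "lead_ideal A t I d =
     {c \<in> A. \<exists>r. (\<forall>i. r i \<in> A) \<and> c * t ^ d + (\<Sum>i<d. r i * t ^ i) \<in> I}"

definition adjoin :: "'u::ring_1 set \<Rightarrow> 'u \<Rightarrow> 'u set" where
  "adjoin A t = {(\<Sum>i<d. r i * t ^ i) | r d. \<forall>i. r i \<in> A}"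

lemma adjoinI: "(\<And>i. r i \<in> A) \<Longrightarrow> x = (\<Sum>i<d. r i * t ^ i) \<Longrightarrow> x \<in> adjoin A t"
  unfolding adjoin_def by blast

locale comm_subring_extension = B: comm_subring B + comm_subring A for A B :: "'u::ring_1 set" +
  fixes t :: 'u
  assumes sub: "A \<subseteq> B" and t_closed: "t \<in> B"
begin

lemma lead_ideal_ideal:
  assumes I: "ideal_in B I"
  shows "ideal_in A (lead_ideal A t I d)"
  unfolding ideal_in_def
proof (intro conjI ballI)
  show "lead_ideal A t I d \<subseteq> A" by (auto simp: lead_ideal_def)
  show "0 \<in> lead_ideal A t I d"
    using I zero_closed by (auto simp: lead_ideal_def ideal_in_def intro!: exI[of _ "\<lambda>_. 0"])
next
  fix a b assume "a \<in> lead_ideal A t I d" "b \<in> lead_ideal A t I d"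
  then obtain r s where
    r: "a \<in> A" "\<forall>i. r i \<in> A" "a * t ^ d + (\<Sum>i<d. r i * t ^ i) \<in> I" and
    s: "b \<in> A" "\<forall>i. s i \<in> A" "b * t ^ d + (\<Sum>i<d. s i * t ^ i) \<in> I"
    by (auto simp: lead_ideal_def)
  have "(a + b) * t ^ d + (\<Sum>i<d. (r i + s i) * t ^ i) =
      (a * t ^ d + (\<Sum>i<d. r i * t ^ i)) + (b * t ^ d + (\<Sum>i<d. s i * t ^ i))"
    by (simp add: sum.distrib algebra_simps)
  also have "\<dots> \<in> I" using I r(3) s(3) by (simp add: ideal_in_def)
  finally have "(a + b) * t ^ d + (\<Sum>i<d. (r i + s i) * t ^ i) \<in> I" .
  then show "a + b \<in> lead_ideal A t I d"
    using r s add_closed by (auto simp: lead_ideal_def intro!: exI[of _ "\<lambda>i. r i + s i"])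
next
  fix g a assume g: "g \<in> A" and "a \<in> lead_ideal A t I d"
  then obtain r where
    r: "a \<in> A" "\<forall>i. r i \<in> A" "a * t ^ d + (\<Sum>i<d. r i * t ^ i) \<in> I"
    by (auto simp: lead_ideal_def)
  have "(g * a) * t ^ d + (\<Sum>i<d. (g * r i) * t ^ i) = g * (a * t ^ d + (\<Sum>i<d. r i * t ^ i))"
    by (simp add: sum_distrib_left algebra_simps)
  also have "\<dots> \<in> I" using I r(3) g sub by (auto simp: ideal_in_def)
  finally have "(g * a) * t ^ d + (\<Sum>i<d. (g * r i) * t ^ i) \<in> I" .
  then show "g * a \<in> lead_ideal A t I d"
    using r g mult_closed by (auto simp: lead_ideal_def intro!: exI[of _ "\<lambda>i. g * r i"])
qed

lemma lead_ideal_mono: "I \<subseteq> J \<Longrightarrow> lead_ideal A t I d \<subseteq> lead_ideal A t J d"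
  by (auto simp: lead_ideal_def)

text \<open>Multiplication by \<open>t\<close> shifts the lower coefficients by one place and keeps
  the leading one.\<close>

lemma lead_ideal_Suc:
  assumes I: "ideal_in B I"
  shows "lead_ideal A t I d \<subseteq> lead_ideal A t I (Suc d)"
proof
  fix c assume "c \<in> lead_ideal A t I d"
  then obtain r where
    r: "c \<in> A" "\<forall>i. r i \<in> A" "c * t ^ d + (\<Sum>i<d. r i * t ^ i) \<in> I"
    by (auto simp: lead_ideal_def)
  define r' where "r' i = (case i of 0 \<Rightarrow> 0 | Suc j \<Rightarrow> r j)" for i
  have tr: "t * (b * y) = b * (t * y)" if "b \<in> A" for b y
    using B.commute[OF t_closed, of b] that sub by (metis mult.assoc subsetD)
  have "c * t ^ Suc d + (\<Sum>i<Suc d. r' i * t ^ i) = t * (c * t ^ d + (\<Sum>i<d. r i * t ^ i))"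
    unfolding sum.lessThan_Suc_shift using r
    by (simp add: r'_def distrib_left sum_distrib_left tr)
  also have "\<dots> \<in> I" using I r(3) t_closed by (auto simp: ideal_in_def)
  finally have "c * t ^ Suc d + (\<Sum>i<Suc d. r' i * t ^ i) \<in> I" .
  moreover have "r' i \<in> A" for i using r zero_closed by (auto simp: r'_def split: nat.splits)
  ultimately show "c \<in> lead_ideal A t I (Suc d)"
    using r unfolding lead_ideal_def by blast
qed

lemma lead_ideal_le: "ideal_in B I \<Longrightarrow> d \<le> e \<Longrightarrow> lead_ideal A t I d \<subseteq> lead_ideal A t I e"
  using lift_Suc_mono_le[of "lead_ideal A t I" d e] lead_ideal_Suc by auto

text \<open>Induction on the length of an expression in \<open>J\<close>: some element of
  \<open>I\<close> has the same top coefficient in the same degree, and subtracting it leaves a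
  shorter expression that is still in \<open>J\<close>.\<close>

lemma ideal_eq_of_lead_ideal_eq:
  assumes gen: "B \<subseteq> adjoin A t" and I: "ideal_in B I" and J: "ideal_in B J"
    and IJ: "I \<subseteq> J" and eq: "\<And>d. lead_ideal A t J d \<subseteq> lead_ideal A t I d"
  shows "J = I"
proof
  have *: "(\<forall>i. r i \<in> A) \<Longrightarrow> (\<Sum>i<d. r i * t ^ i) \<in> J \<Longrightarrow> (\<Sum>i<d. r i * t ^ i) \<in> I" for r d
  proof (induction d arbitrary: r)
    case 0
    then show ?case using I by (simp add: ideal_in_def)
  next
    case (Suc d)
    have "r d \<in> lead_ideal A t J d"
      using Suc.prems by (auto simp: lead_ideal_def algebra_simps)
    then have "r d \<in> lead_ideal A t I d" using eq by blast
    then obtain s where s: "\<forall>i. s i \<in> A" "r d * t ^ d + (\<Sum>i<d. s i * t ^ i) \<in> I"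
      by (auto simp: lead_ideal_def)
    have e: "(\<Sum>i<d. (r i - s i) * t ^ i) =
        (\<Sum>i<Suc d. r i * t ^ i) - (r d * t ^ d + (\<Sum>i<d. s i * t ^ i))"
      by (simp add: left_diff_distrib sum_subtractf)
    have "(\<Sum>i<d. (r i - s i) * t ^ i) \<in> J"
      unfolding e using Suc.prems s IJ B.ideal_diff[OF J] by blast
    then have "(\<Sum>i<d. (r i - s i) * t ^ i) \<in> I"
      using Suc.IH[of "\<lambda>i. r i - s i"] Suc.prems s diff_closed by blast
    then have "(\<Sum>i<d. (r i - s i) * t ^ i) + (r d * t ^ d + (\<Sum>i<d. s i * t ^ i)) \<in> I"
      using s I by (simp add: ideal_in_def)
    then show ?case unfolding e by simp
  qed
  show "J \<subseteq> I"
  proof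
    fix z assume z: "z \<in> J"
    then have "z \<in> adjoin A t" using J gen by (auto simp: ideal_in_def)
    then obtain r d where "\<forall>i. r i \<in> A" "z = (\<Sum>i<d. r i * t ^ i)"
      by (auto simp: adjoin_def)
    then show "z \<in> I" using * z by blast
  qed
qed (rule IJ)

text \<open>The diagonal \<open>j \<mapsto> lead_ideal A t (f j) j\<close> stabilises at some \<open>N\<close>, which settles all
  degrees \<open>\<ge> N\<close> at once; the finitely many smaller degrees are treated separately.\<close>
theorem hilbert_basis:
  assumes gen: "B \<subseteq> adjoin A t" and A: "acc_ideals A"
  shows "acc_ideals B"
  unfolding acc_ideals_def
proof (intro allI impI, elim conjE)
  fix f :: "nat \<Rightarrow> 'u set" assume f: "\<forall>i. ideal_in B (f i)" and "mono f"
  then have mf: "f i \<subseteq> f j" if "i \<le> j" for i j using that by (simp add: mono_def)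
  let ?L = "\<lambda>d j. lead_ideal A t (f j) d"
  have L: "?L d j \<subseteq> ?L e k" if "d \<le> e" "j \<le> k" for d e j k
    using lead_ideal_le[OF f[rule_format] \<open>d \<le> e\<close>] lead_ideal_mono[OF mf[OF \<open>j \<le> k\<close>]] by blast
  have stab: "\<exists>N. \<forall>i\<ge>N. h i = h N" if "\<And>i. ideal_in A (h i)" "mono h" for h :: "nat \<Rightarrow> 'u set"
    using A that unfolding acc_ideals_def by blast
  obtain N where N: "?L i i = ?L N N" if "i \<ge> N" for i
    using stab[of "\<lambda>j. ?L j j"] L lead_ideal_ideal f by (auto simp: mono_def)
  have "\<exists>n. \<forall>j\<ge>n. ?L d j = ?L d n" for d
    using stab[of "\<lambda>j. ?L d j"] L lead_ideal_ideal f by (auto simp: mono_def)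
  then obtain n where n: "\<And>d j. j \<ge> n d \<Longrightarrow> ?L d j = ?L d (n d)" by metis
  \<comment> \<open>The sum is a crude common bound for the finitely many stabilisation indices
    \<open>n d\<close> with \<open>d < N\<close>.\<close>
  define m where "m = N + (\<Sum>d<N. n d)"
  have nm: "n d \<le> m" if "d < N" for d
  proof -
    have "n d \<le> (\<Sum>d<N. n d)" using that by (intro member_le_sum) auto
    then show ?thesis by (simp add: m_def)
  qed
  have "f j = f m" if j: "j \<ge> m" for j
  proof (rule ideal_eq_of_lead_ideal_eq[OF gen])
    fix d show "?L d j \<subseteq> ?L d m"
    proof (cases "d < N")
      case True
      then show ?thesis using n[of d j] n[of d m] nm[OF True] j by auto
    next
      case False
      \<comment> \<open>For \<open>d \<ge> N\<close> the comparison runs through the diagonal, which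
        is constant from \<open>N\<close> on.\<close>
      have "?L d j \<subseteq> ?L (max d j) (max d j)" by (rule L) auto
      also have "\<dots> = ?L N N" using False by (intro N) auto
      also have "\<dots> \<subseteq> ?L d m" using False by (intro L) (auto simp: m_def)
      finally show ?thesis .
    qed
  qed (use f mf j in auto)
  then show "\<exists>N. \<forall>i\<ge>N. f i = f N" by blast
qed

end

lemma (in comm_subring) adjoin_add:
  assumes "x \<in> adjoin A t" "y \<in> adjoin A t"
  shows "x + y \<in> adjoin A t"
proof -
  obtain r d where r: "\<forall>i. r i \<in> A" "x = (\<Sum>i<d. r i * t ^ i)"
    using assms by (auto simp: adjoin_def)
  obtain s e where s: "\<forall>i. s i \<in> A" "y = (\<Sum>i<e. s i * t ^ i)"
    using assms by (auto simp: adjoin_def)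
  \<comment> \<open>The sequences are cut off at their own lengths because \<open>r\<close> and
    \<open>s\<close> may take any values in \<open>A\<close> beyond them.\<close>
  let ?r = "\<lambda>i. (if i < d then r i else 0) + (if i < e then s i else 0)"
  have "x = (\<Sum>i<max d e. (if i < d then r i else 0) * t ^ i)"
    unfolding r by (rule sum.mono_neutral_cong_left) auto
  moreover have "y = (\<Sum>i<max d e. (if i < e then s i else 0) * t ^ i)"
    unfolding s by (rule sum.mono_neutral_cong_left) auto
  ultimately have "x + y = (\<Sum>i<max d e. ?r i * t ^ i)"
    by (simp only: sum.distrib distrib_right)
  then show ?thesis using r s zero_closed add_closed by (intro adjoinI[of ?r]) auto
qed

lemma (in comm_subring) adjoin_base: "a \<in> A \<Longrightarrow> a \<in> adjoin A t"
  by (rule adjoinI[of "\<lambda>_. a" A a t 1]) auto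

lemma (in comm_subring) adjoin_var: "t \<in> adjoin A t"
  using zero_closed one_closed
  by (intro adjoinI[of "\<lambda>i. if i = 1 then 1 else 0" A t t 2]) (auto simp: numeral_2_eq_2)

text \<open>Only \<open>x\<close> is expanded: multiplication by \<open>t\<close> and by constants
  preserves \<open>adjoin A t\<close>, hence so does multiplication by each term
  \<open>r i * t ^ i\<close>, and the terms add up.\<close>

lemma (in comm_subring_extension) adjoin_mult:
  assumes x: "x \<in> adjoin A t" and y: "y \<in> adjoin A t"
  shows "x * y \<in> adjoin A t"
proof -
  have tr: "t * (b * z) = b * (t * z)" if "b \<in> A" for b z
    using B.commute[OF t_closed, of b] that sub by (metis mult.assoc subsetD)
  have ty: "t * y \<in> adjoin A t" if y: "y \<in> adjoin A t" for y
  proof -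
    obtain r d where r: "\<forall>i. r i \<in> A" "y = (\<Sum>i<d. r i * t ^ i)"
      using y by (auto simp: adjoin_def)
    define r' where "r' i = (case i of 0 \<Rightarrow> 0 | Suc j \<Rightarrow> r j)" for i
    have "t * y = (\<Sum>i<Suc d. r' i * t ^ i)"
      unfolding sum.lessThan_Suc_shift r(2) using r(1)
      by (simp add: r'_def sum_distrib_left tr)
    moreover have "r' i \<in> A" for i using r zero_closed by (auto simp: r'_def split: nat.splits)
    ultimately show ?thesis unfolding adjoin_def by blast
  qed
  have cy: "c * y \<in> adjoin A t" if y: "y \<in> adjoin A t" and c: "c \<in> A" for c y
  proof -
    obtain r d where r: "\<forall>i. r i \<in> A" "y = (\<Sum>i<d. r i * t ^ i)"
      using y by (auto simp: adjoin_def)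
    have "c * y = (\<Sum>i<d. (c * r i) * t ^ i)"
      by (simp add: r(2) sum_distrib_left mult.assoc)
    then show ?thesis using r c mult_closed by (intro adjoinI[of "\<lambda>i. c * r i"]) auto
  qed
  have py: "t ^ i * y \<in> adjoin A t" for i
    by (induction i) (use ty y in \<open>simp_all add: mult.assoc\<close>)
  obtain r d where r: "\<forall>i. r i \<in> A" "x = (\<Sum>i<d. r i * t ^ i)"
    using x by (auto simp: adjoin_def)
  have "(\<Sum>i<d. r i * t ^ i) * y \<in> adjoin A t"
  proof (induction d)
    case 0
    then show ?case using adjoin_base[OF zero_closed] by simp
  next
    case (Suc d)
    then show ?case using adjoin_add[OF Suc cy[OF py, of "r d" d]] r(1)
      by (simp add: distrib_right mult.assoc)
  qed
  then show ?thesis using r by simp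
qed

section \<open>Finitely generated commutative algebras are noetherian\<close>

context
  fixes emb :: "'k::field \<Rightarrow> 'u::ring_1" and G :: "'u set"
  assumes alg: "is_K_algebra emb" and G: "comm_subalgebra emb G"
begin

lemma emb_add: "emb (a + b) = emb a + emb b"
  and emb_mult: "emb (a * b) = emb a * emb b"
  and emb_one: "emb 1 = 1"
  using alg unfolding is_K_algebra_def by blast+

lemma emb_zero: "emb 0 = 0"
  using emb_add[of 0 0] by simp

lemma emb_minus_one: "emb (- 1) = - 1"
  using emb_add[of "- 1" 1] by (simp add: emb_zero emb_one eq_neg_iff_add_eq_0)

lemma comm_subring_subalgebra: "comm_subring G"
proof
  have emb: "emb c \<in> G" for c using G by (auto simp: comm_subalgebra_def)
  show "1 \<in> G" "- 1 \<in> G" using emb[of 1] emb[of "- 1"] by (simp_all add: emb_one emb_minus_one)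
qed (use G in \<open>unfold comm_subalgebra_def, blast+\<close>)

lemma subalg_gen_subset:
  assumes "S \<subseteq> G"
  shows "subalg_gen emb S \<subseteq> G"
proof
  fix z assume "z \<in> subalg_gen emb S"
  then show "z \<in> G"
    by induction (use assms G in \<open>unfold comm_subalgebra_def, blast+\<close>)
qed

lemma comm_subring_subalg_gen:
  assumes "S \<subseteq> G"
  shows "comm_subring (subalg_gen emb S)"
proof
  show "1 \<in> subalg_gen emb S" using subalg_gen.gen_scalar[of emb 1 S]
    by (simp add: emb_one)
  show "- 1 \<in> subalg_gen emb S" using subalg_gen.gen_scalar[of emb "- 1" S]
    by (simp add: emb_minus_one)
  show "a * b = b * a" if "a \<in> subalg_gen emb S" "b \<in> subalg_gen emb S" for a b
    using that subalg_gen_subset[OF assms] G unfolding comm_subalgebra_def by blast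
qed (auto intro: subalg_gen.intros)

text \<open>This subalgebra is the image of a field, so its only ideals are zero and the whole ring;
  a chain that never reaches the whole ring is constantly zero.\<close>

lemma acc_ideals_subalg_gen_empty: "acc_ideals (subalg_gen emb {})"
  unfolding acc_ideals_def
proof (intro allI impI, elim conjE)
  let ?A = "subalg_gen emb {}"
  have A: "?A \<subseteq> range emb"
  proof
    fix z assume "z \<in> ?A"
    then show "z \<in> range emb"
    proof induction
      case (gen_add a b)
      then obtain c d where "a = emb c" "b = emb d" by blast
      then have "a + b = emb (c + d)" by (simp add: emb_add)
      then show ?case by blast
    next
      case (gen_mult a b)
      then obtain c d where "a = emb c" "b = emb d" by blast
      then have "a * b = emb (c * d)" by (simp add: emb_mult)
      then show ?case by blast
    qed auto
  qed
  have triv: "I = {0} \<or> I = ?A" if I: "ideal_in ?A I" for I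
  proof (cases "I \<subseteq> {0}")
    case True
    then show ?thesis using I by (auto simp: ideal_in_def)
  next
    case False
    then obtain c where c: "emb c \<in> I" "emb c \<noteq> 0"
      using I A unfolding ideal_in_def by fast
    then have "c \<noteq> 0" using emb_zero by auto
    then have "emb (inverse c) * emb c = 1"
      using emb_mult[of "inverse c" c] by (simp add: emb_one)
    moreover have "emb (inverse c) * emb c \<in> I"
      using I c subalg_gen.gen_scalar[of emb "inverse c"] by (simp add: ideal_in_def)
    ultimately have "1 \<in> I" by simp
    then have "g \<in> I" if "g \<in> ?A" for g
      using I that unfolding ideal_in_def by (metis mult.right_neutral)
    then show ?thesis using I by (auto simp: ideal_in_def)
  qed
  fix f :: "nat \<Rightarrow> 'u set" assume f: "\<forall>i. ideal_in ?A (f i)" and "mono f"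
  show "\<exists>N. \<forall>i\<ge>N. f i = f N"
  proof (cases "\<exists>N. f N = ?A")
    case True
    then obtain N where N: "f N = ?A" by blast
    have "f i = f N" if "i \<ge> N" for i
    proof
      show "f N \<subseteq> f i" using \<open>mono f\<close> that by (simp add: mono_def)
      show "f i \<subseteq> f N" unfolding N using f by (auto simp: ideal_in_def)
    qed
    then show ?thesis by blast
  next
    case False
    then show ?thesis using triv f by metis
  qed
qed

text \<open>Induction on the generators, each new one being adjoined by
  \<open>hilbert_basis\<close>.\<close>

lemma acc_ideals_subalg_gen:
  assumes "finite S" "S \<subseteq> G"
  shows "acc_ideals (subalg_gen emb S)"
  using assms
proof (induction S rule: finite_induct)
  case empty
  show ?case by (rule acc_ideals_subalg_gen_empty)
next
  case (insert t S)
  let ?A = "subalg_gen emb S" and ?B = "subalg_gen emb (insert t S)"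
  have AB: "?A \<subseteq> ?B"
  proof
    fix z assume "z \<in> ?A" then show "z \<in> ?B" by induction (auto intro: subalg_gen.intros)
  qed
  interpret A: comm_subring ?A using insert.prems by (intro comm_subring_subalg_gen) auto
  interpret B: comm_subring ?B using insert.prems by (intro comm_subring_subalg_gen) auto
  interpret comm_subring_extension ?A ?B t
    by standard (use AB in \<open>auto intro: subalg_gen.intros\<close>)
  have "?B \<subseteq> adjoin ?A t"
  proof
    fix z assume "z \<in> ?B"
    then show "z \<in> adjoin ?A t"
      by induction (auto intro: adjoin_mult A.adjoin_add A.adjoin_var A.adjoin_base subalg_gen.intros)
  qed
  then show ?case using insert by (intro hilbert_basis) auto
qed

end

section \<open>Torsion with respect to a set of primes\<close>

lemma ideal_in_memD: "ideal_in A I \<Longrightarrow> a \<in> I \<Longrightarrow> a \<in> A"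
  unfolding ideal_in_def by blast

text \<open>A well-founded form of being killed by a product of primes from \<open>R\<close>: after
  the first prime \<open>P\<close>, the later ones may depend on \<open>g\<close>. The induction
  rule strips off one prime at a time.\<close>

inductive_set prime_torsion ::
  "('u \<Rightarrow> 'm::ab_group_add \<Rightarrow> 'm) \<Rightarrow> 'u set set \<Rightarrow> 'm set"
  for act :: "'u \<Rightarrow> 'm \<Rightarrow> 'm" and R :: "'u set set" where
  zero: "0 \<in> prime_torsion act R"
| step: "P \<in> R \<Longrightarrow> (\<And>g. g \<in> P \<Longrightarrow> act g m \<in> prime_torsion act R) \<Longrightarrow> m \<in> prime_torsion act R"

text \<open>The kernel of the map from \<open>M\<close> to its localisation at \<open>q\<close>;
  statements about the localised module are phrased as statements modulo this kernel.\<close>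

definition loc_kernel :: "'u::ring_1 set \<Rightarrow> ('u \<Rightarrow> 'm::ab_group_add \<Rightarrow> 'm) \<Rightarrow> 'u set \<Rightarrow> 'm set" where
  "loc_kernel G act q = {m. \<exists>s\<in>G - q. act s m = 0}"

locale comm_module = comm_subring G for G :: "'u::ring_1 set" +
  fixes act :: "'u \<Rightarrow> 'm::ab_group_add \<Rightarrow> 'm"
  assumes is_module: "is_module act"
begin

lemma act_add_left: "act (a + b) m = act a m + act b m"
  and act_add_right: "act a (m + m') = act a m + act a m'"
  and act_mult: "act (a * b) m = act a (act b m)"
  and act_one: "act 1 m = m"
  using is_module unfolding is_module_def by blast+

lemma act_zero_left: "act 0 m = 0"
  using act_add_left[of 0 0 m] by simp

lemma act_zero_right: "act a 0 = 0"
  using act_add_right[of a 0 0] by simp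

lemma act_neg_left: "act (- a) m = - act a m"
  using act_add_left[of "- a" a m] by (simp add: act_zero_left eq_neg_iff_add_eq_0)

lemma act_neg_right: "act a (- m) = - act a m"
  using act_add_right[of a "- m" m] by (simp add: act_zero_right eq_neg_iff_add_eq_0)

lemma act_diff_left: "act (a - b) m = act a m - act b m"
  by (metis act_add_left act_neg_left diff_conv_add_uminus)

lemma act_diff_right: "act a (m - m') = act a m - act a m'"
  by (metis act_add_right act_neg_right diff_conv_add_uminus)

lemma act_sum_left: "act (sum f I) m = (\<Sum>i\<in>I. act (f i) m)"
  by (induction I rule: infinite_finite_induct) (auto simp: act_zero_left act_add_left)

lemma act_sum_right: "act a (sum f I) = (\<Sum>i\<in>I. act a (f i))"
  by (induction I rule: infinite_finite_induct) (auto simp: act_zero_right act_add_right)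

lemma act_commute: "a \<in> G \<Longrightarrow> b \<in> G \<Longrightarrow> act a (act b m) = act b (act a m)"
  by (metis act_mult commute)

lemma ideal_ann_in: "ideal_in G (ann_in G act m)"
  unfolding ideal_in_def ann_in_def
  by (auto simp: zero_closed add_closed mult_closed act_zero_left act_zero_right act_add_left act_mult)

lemma ex_maximal_ann:
  assumes acc: "acc_ideals G" and ex: "\<exists>m. Q m"
  shows "\<exists>m. Q m \<and> (\<forall>m'. Q m' \<longrightarrow> ann_in G act m \<subseteq> ann_in G act m' \<longrightarrow> ann_in G act m' = ann_in G act m)"
proof -
  have "\<exists>I\<in>ann_in G act ` {m. Q m}. \<forall>J\<in>ann_in G act ` {m. Q m}. I \<subseteq> J \<longrightarrow> J = I"
    by (rule acc_ideals_maximal[OF acc]) (use ex ideal_ann_in in auto)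
  then show ?thesis by simp
qed

text \<open>An annihilator that is maximal among those of nonzero multiples of \<open>z\<close> is
  prime: if \<open>b\<close> does not kill \<open>c z\<close>, then \<open>b c z\<close> has the
  same annihilator by maximality, and any \<open>a\<close> with \<open>a b c z = 0\<close> lies in
  it.\<close>

lemma ex_associated_prime:
  assumes acc: "acc_ideals G" and "z \<noteq> 0"
  shows "\<exists>c\<in>G. ann_in G act (act c z) \<in> Ass G act"
proof -
  have "\<exists>m. \<exists>c\<in>G. m = act c z \<and> m \<noteq> 0" using \<open>z \<noteq> 0\<close> one_closed act_one by metis
  from ex_maximal_ann[OF acc this] obtain c where c: "c \<in> G" "act c z \<noteq> 0"
    and max: "\<And>d. d \<in> G \<Longrightarrow> act d z \<noteq> 0 \<Longrightarrow> ann_in G act (act c z) \<subseteq> ann_in G act (act d z) \<Longrightarrow>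
      ann_in G act (act d z) = ann_in G act (act c z)"
    by blast
  have "prime_ideal_in G (ann_in G act (act c z))"
    unfolding prime_ideal_in_def
  proof (intro conjI ballI impI)
    show "ann_in G act (act c z) \<noteq> G"
    proof
      assume "ann_in G act (act c z) = G"
      then have "1 \<in> ann_in G act (act c z)" using one_closed by simp
      then show False using c by (simp add: ann_in_def act_one)
    qed
    fix a b assume ab: "a \<in> G" "b \<in> G" "a * b \<in> ann_in G act (act c z)"
    show "a \<in> ann_in G act (act c z) \<or> b \<in> ann_in G act (act c z)"
    proof (cases "act b (act c z) = 0")
      case False
      have "act g (act (b * c) z) = 0" if "g \<in> ann_in G act (act c z)" for g
        using that ab(2) act_commute[of g b "act c z"] by (simp add: ann_in_def act_mult act_zero_right)
      then have "ann_in G act (act (b * c) z) = ann_in G act (act c z)"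
        using False ab c by (intro max) (auto simp: act_mult mult_closed ann_in_def)
      moreover have "a \<in> ann_in G act (act (b * c) z)"
        using ab by (simp add: ann_in_def act_mult)
      ultimately show ?thesis by simp
    qed (use ab in \<open>simp add: ann_in_def\<close>)
  qed (rule ideal_ann_in)
  then show ?thesis using c by (auto simp: Ass_def)
qed

lemma prime_torsion_act:
  assumes "m \<in> prime_torsion act R" "g \<in> G" and R: "\<And>P. P \<in> R \<Longrightarrow> ideal_in G P"
  shows "act g m \<in> prime_torsion act R"
  using assms(1)
proof induction
  case zero
  then show ?case by (simp add: act_zero_right prime_torsion.zero)
next
  case (step P m)
  show ?case
  proof (rule prime_torsion.step[OF step(1)])
    fix h assume h: "h \<in> P"
    then have "h \<in> G" using ideal_in_memD[OF R[OF step(1)]] by blast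
    then show "act h (act g m) \<in> prime_torsion act R"
      using step h assms(2) by (simp add: act_commute)
  qed
qed

lemma prime_torsion_add:
  assumes "m \<in> prime_torsion act R" "m' \<in> prime_torsion act R"
    and R: "\<And>P. P \<in> R \<Longrightarrow> ideal_in G P"
  shows "m + m' \<in> prime_torsion act R"
  using assms(1,2)
proof (induction arbitrary: m')
  case zero
  then show ?case by simp
next
  case (step P m)
  show ?case
  proof (rule prime_torsion.step[OF step(1)])
    fix h assume h: "h \<in> P"
    then have "h \<in> G" using ideal_in_memD[OF R[OF step(1)]] by blast
    then show "act h (m + m') \<in> prime_torsion act R"
      using step h prime_torsion_act[OF _ _ R] by (simp add: act_add_right)
  qed
qed

text \<open>Take a counterexample \<open>z\<close> with maximal annihilator and an associated prime
  \<open>ann (c z)\<close>, which lies in \<open>R\<close>. Some \<open>g\<close> in this prime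
  leaves \<open>g z\<close> non-torsion, so \<open>g z\<close> has the same annihilator as
  \<open>z\<close>; but \<open>c\<close> kills \<open>g z\<close> and not \<open>z\<close>.\<close>

lemma subset_prime_torsion:
  assumes acc: "acc_ideals G"
    and W: "\<And>g w. g \<in> G \<Longrightarrow> w \<in> W \<Longrightarrow> act g w \<in> W"
    and R: "\<And>w. w \<in> W \<Longrightarrow> ann_in G act w \<in> Ass G act \<Longrightarrow> ann_in G act w \<in> R"
  shows "W \<subseteq> prime_torsion act R"
proof (rule ccontr)
  assume "\<not> W \<subseteq> prime_torsion act R"
  then have "\<exists>z. z \<in> W \<and> z \<notin> prime_torsion act R" by blast
  from ex_maximal_ann[OF acc this] obtain z where z: "z \<in> W" "z \<notin> prime_torsion act R"
    and max: "\<And>y. y \<in> W \<Longrightarrow> y \<notin> prime_torsion act R \<Longrightarrow> ann_in G act z \<subseteq> ann_in G act y \<Longrightarrow>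
      ann_in G act y = ann_in G act z"
    by blast
  have "z \<noteq> 0" using z prime_torsion.zero by blast
  then obtain c where c: "c \<in> G" and P: "ann_in G act (act c z) \<in> Ass G act"
    using ex_associated_prime[OF acc] by blast
  have "ann_in G act (act c z) \<in> R" using R[OF W] c z P by blast
  then obtain g where g: "g \<in> ann_in G act (act c z)" "act g z \<notin> prime_torsion act R"
    using prime_torsion.step z(2) by metis
  have gG: "g \<in> G" using g by (simp add: ann_in_def)
  have "ann_in G act z \<subseteq> ann_in G act (act g z)"
  proof
    fix h assume h: "h \<in> ann_in G act z"
    then show "h \<in> ann_in G act (act g z)"
      using act_commute[of h g z] gG by (simp add: ann_in_def act_zero_right)
  qed
  then have "ann_in G act (act g z) = ann_in G act z"
    using W[OF gG z(1)] g(2) by (intro max) auto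
  moreover have "c \<in> ann_in G act (act g z)"
    using g c gG act_commute[of g c z] by (simp add: ann_in_def)
  ultimately have "act c z = 0" by (simp add: ann_in_def)
  then have "1 \<in> ann_in G act (act c z)" using one_closed act_zero_right by (simp add: ann_in_def)
  then show False using prime_one P by (auto simp: Ass_def)
qed

section \<open>Localisation at a prime\<close>

context
  fixes q assumes q: "prime_ideal_in G q"
begin

lemma loc_kernel_zero: "0 \<in> loc_kernel G act q"
  unfolding loc_kernel_def using prime_one[OF q] one_closed act_zero_right by auto

lemma loc_kernel_add:
  assumes "m \<in> loc_kernel G act q" "m' \<in> loc_kernel G act q"
  shows "m + m' \<in> loc_kernel G act q"
proof -
  obtain s s' where s: "s \<in> G - q" "act s m = 0" "s' \<in> G - q" "act s' m' = 0"
    using assms by (auto simp: loc_kernel_def)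
  have "act (s * s') m = 0"
    using s act_commute[of s s' m] by (simp add: act_mult act_zero_right)
  then have "act (s * s') (m + m') = 0"
    using s by (simp add: act_add_right act_mult act_zero_right)
  moreover have "s * s' \<in> G - q" using s q mult_closed by (auto simp: prime_ideal_in_def)
  ultimately show ?thesis by (auto simp: loc_kernel_def)
qed

lemma loc_kernel_act:
  assumes "m \<in> loc_kernel G act q" "g \<in> G"
  shows "act g m \<in> loc_kernel G act q"
proof -
  obtain s where s: "s \<in> G - q" "act s m = 0" using assms by (auto simp: loc_kernel_def)
  then have "act s (act g m) = 0" using act_commute[of s g m] assms by (simp add: act_zero_right)
  then show ?thesis using s by (auto simp: loc_kernel_def)
qed

lemma loc_kernel_sum:
  "(\<And>i. i \<in> I \<Longrightarrow> f i \<in> loc_kernel G act q) \<Longrightarrow> sum f I \<in> loc_kernel G act q"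
  by (induction I rule: infinite_finite_induct) (auto intro: loc_kernel_zero loc_kernel_add)

text \<open>Elements outside \<open>q\<close> become invertible after localisation.\<close>

lemma loc_kernel_cancel:
  assumes "act s m \<in> loc_kernel G act q" "s \<in> G - q"
  shows "m \<in> loc_kernel G act q"
proof -
  obtain r where r: "r \<in> G - q" "act r (act s m) = 0" using assms by (auto simp: loc_kernel_def)
  then have "act (r * s) m = 0" by (simp add: act_mult)
  moreover have "r * s \<in> G - q" using r assms q mult_closed by (auto simp: prime_ideal_in_def)
  ultimately show ?thesis by (auto simp: loc_kernel_def)
qed

text \<open>Nakayama's lemma over the localisation at \<open>q\<close>, by eliminating one generator at a time.\<close>
lemma nakayama:
  assumes "finite F"
    and "\<forall>f\<in>F. \<exists>s\<in>G - q. \<exists>c. (\<forall>f'. c f' \<in> q) \<and>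
      act s (w f) - (\<Sum>f'\<in>F. act (c f') (w f')) \<in> loc_kernel G act q"
  shows "\<forall>f\<in>F. w f \<in> loc_kernel G act q"
  using assms
proof (induction F rule: finite_induct)
  case empty
  then show ?case by simp
next
  case (insert g F)
  have I: "ideal_in G q" using q by (simp add: prime_ideal_in_def)
  obtain s c where s: "s \<in> G - q" and c: "\<And>f. c f \<in> q"
    and sc: "act s (w g) - (\<Sum>f'\<in>insert g F. act (c f') (w f')) \<in> loc_kernel G act q"
    using insert.prems by blast
  \<comment> \<open>The coefficient of \<open>w g\<close> once its own term is moved to the left; it
    stays outside \<open>q\<close> because \<open>c g\<close> lies in \<open>q\<close>.\<close>
  define s0 where "s0 = s - c g"
  have qG: "a \<in> G" if "a \<in> q" for a using I that by (auto simp: ideal_in_def)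
  have s0: "s0 \<in> G - q"
  proof -
    have "s0 + c g \<notin> q" using s by (simp add: s0_def)
    then have "s0 \<notin> q" using c I by (auto simp: ideal_in_def)
    then show ?thesis using s c qG diff_closed by (auto simp: s0_def)
  qed
  have sc0: "act s0 (w g) - (\<Sum>f'\<in>F. act (c f') (w f')) \<in> loc_kernel G act q"
    using sc insert.hyps by (simp add: s0_def act_diff_left algebra_simps)
  have "\<forall>f\<in>F. w f \<in> loc_kernel G act q"
  proof (rule insert.IH, intro ballI)
    fix f assume "f \<in> F"
    then obtain t d where t: "t \<in> G - q" and d: "\<And>f. d f \<in> q"
      and td: "act t (w f) - (\<Sum>f'\<in>insert g F. act (d f') (w f')) \<in> loc_kernel G act q"
      using insert.prems by blast
    \<comment> \<open>Multiplying the relation for \<open>w f\<close> by \<open>s0\<close> and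
      substituting the one for \<open>s0\<close> times \<open>w g\<close> eliminates
      \<open>w g\<close>; the new coefficients are again in \<open>q\<close>.\<close>
    let ?e = "\<lambda>f'. s0 * d f' + d g * c f'"
    have "act (s0 * t) (w f) - (\<Sum>f'\<in>F. act (?e f') (w f')) =
        act s0 (act t (w f) - (\<Sum>f'\<in>insert g F. act (d f') (w f'))) +
        act (d g) (act s0 (w g) - (\<Sum>f'\<in>F. act (c f') (w f')))"
      using insert.hyps s0 d qG act_commute[of s0 "d g" "w g"]
      by (simp add: act_diff_right act_add_right act_add_left act_mult act_sum_right sum.distrib algebra_simps)
    also have "\<dots> \<in> loc_kernel G act q"
      by (intro loc_kernel_add loc_kernel_act td sc0) (use s0 d qG in auto)
    finally have "act (s0 * t) (w f) - (\<Sum>f'\<in>F. act (?e f') (w f')) \<in> loc_kernel G act q" .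
    moreover have "s0 * t \<in> G - q" using s0 t q mult_closed by (auto simp: prime_ideal_in_def)
    moreover have "\<forall>f'. ?e f' \<in> q" using I d c s0 qG by (simp add: ideal_in_def)
    ultimately show "\<exists>s\<in>G - q. \<exists>c. (\<forall>f'. c f' \<in> q) \<and>
        act s (w f) - (\<Sum>f'\<in>F. act (c f') (w f')) \<in> loc_kernel G act q"
      by (intro bexI[of _ "s0 * t"] exI[of _ ?e]) simp_all
  qed
  moreover have "w g \<in> loc_kernel G act q"
  proof -
    have "(\<Sum>f'\<in>F. act (c f') (w f')) \<in> loc_kernel G act q"
      using calculation c qG by (intro loc_kernel_sum loc_kernel_act) auto
    from loc_kernel_add[OF sc0 this] have "act s0 (w g) \<in> loc_kernel G act q" by simp
    then show ?thesis using s0 by (rule loc_kernel_cancel)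
  qed
  ultimately show ?case by simp
qed

end

section \<open>Bimodules acting on torsion elements\<close>

lemma left_span_repr:
  assumes "finite F" "v \<in> left_span G F"
  shows "\<exists>c. (\<forall>f. c f \<in> G) \<and> v = (\<Sum>f\<in>F. c f * f)"
  using assms(2) unfolding left_span_def
proof induction
  case span_zero
  then show ?case using zero_closed by (intro exI[of _ "\<lambda>_. 0"]) simp
next
  case (span_base s)
  then obtain g f where "g \<in> G" "f \<in> F" "s = g * f" by blast
  then show ?case using assms(1) zero_closed
    by (intro exI[of _ "\<lambda>f'. if f' = f then g else 0"]) (simp add: if_distrib[of "\<lambda>a. a * _"] cong: if_cong)
next
  case (span_add a b)
  then obtain c d where "\<forall>f. c f \<in> G" "a = (\<Sum>f\<in>F. c f * f)" "\<forall>f. d f \<in> G" "b = (\<Sum>f\<in>F. d f * f)"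
    by blast
  then show ?case
    by (intro exI[of _ "\<lambda>f. c f + d f"]) (simp add: add_closed distrib_right sum.distrib)
next
  case (span_neg a)
  then obtain c where "\<forall>f. c f \<in> G" "a = (\<Sum>f\<in>F. c f * f)" by blast
  then show ?case by (intro exI[of _ "\<lambda>f. - c f"]) (simp add: neg_closed sum_negf)
qed

text \<open>Applied with \<open>X = q\<close>, where the span is the submodule \<open>q V m\<close>
  for \<open>V = G v G\<close>.\<close>

lemma addspan_act:
  assumes "z \<in> addspan {act (a * v * b) m | a b. a \<in> X \<and> b \<in> G}" "g \<in> G"
    and "\<And>a. a \<in> X \<Longrightarrow> g * a \<in> X"
  shows "act g z \<in> addspan {act (a * v * b) m | a b. a \<in> X \<and> b \<in> G}"
  using assms(1)
proof induction
  case span_zero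
  then show ?case by (simp add: act_zero_right addspan.span_zero)
next
  case (span_base s)
  then obtain a b where ab: "a \<in> X" "b \<in> G" "s = act (a * v * b) m" by blast
  then have "act g s = act (g * a * v * b) m" by (simp add: act_mult)
  then show ?case using assms(3)[OF ab(1)] ab(2) by (intro addspan.span_base) blast
qed (auto simp: act_add_right act_neg_right intro: addspan.intros)

text \<open>Each filtration step by \<open>P \<in> R\<close> turns \<open>V = q V + V P\<close> into \<open>V m \<subseteq> q V m + V (P m)\<close>.\<close>
lemma act_prime_torsion:
  assumes m: "m \<in> prime_torsion act R"
    and q: "ideal_in G q" and R: "\<And>P. P \<in> R \<Longrightarrow> ideal_in G P"
    and triv: "\<And>P. P \<in> R \<Longrightarrow>
      triple_span G v G \<subseteq> addspan (triple_span q v G \<union> triple_span G v P)"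
  shows "act v m \<in> addspan {act (a * v * b) m | a b. a \<in> q \<and> b \<in> G}"
  using m
proof induction
  case zero
  then show ?case by (simp add: act_zero_right addspan.span_zero)
next
  case (step P m)
  let ?Q = "addspan {act (a * v * b) m | a b. a \<in> q \<and> b \<in> G}"
  have PG: "b \<in> G" if "b \<in> P" for b using ideal_in_memD[OF R[OF step(1)] that] .
  \<comment> \<open>By induction \<open>v b m\<close> lies in \<open>q V (b m)\<close>, and
    \<open>b\<close> is absorbed into the right factor of \<open>V\<close>.\<close>
  have Pm: "act v (act b m) \<in> ?Q" if b: "b \<in> P" for b
  proof -
    have "z \<in> ?Q" if "z \<in> addspan {act (a * v * c) (act b m) | a c. a \<in> q \<and> c \<in> G}" for z
      using that
    proof induction
      case (span_base s)
      then obtain a c where ac: "a \<in> q" "c \<in> G" "s = act (a * v * c) (act b m)" by blast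
      then have "s = act (a * v * (c * b)) m" by (simp add: act_mult)
      then show ?case using ac PG[OF b] mult_closed by (intro addspan.span_base) blast
    qed (auto intro: addspan.intros)
    then show ?thesis using step.IH[OF b] by blast
  qed
  have cl: "act g z \<in> ?Q" if "z \<in> ?Q" "g \<in> G" for g z
    by (rule addspan_act) (use that q in \<open>auto simp: ideal_in_def\<close>)
  have "1 * v * 1 \<in> triple_span G v G"
    unfolding triple_span_def using one_closed by (intro addspan.span_base) blast
  then have "v \<in> addspan (triple_span q v G \<union> triple_span G v P)"
    using triv[OF step(1)] by auto
  moreover have "act y m \<in> ?Q" if "y \<in> addspan (triple_span q v G \<union> triple_span G v P)" for y
    using that
  proof induction
    case (span_base s)
    then show ?case
    proof
      assume "s \<in> triple_span q v G"
      then show ?thesis unfolding triple_span_def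
      proof induction
        case (span_base s)
        then show ?case by (intro addspan.span_base) blast
      qed (auto simp: act_zero_left act_add_left act_neg_left intro: addspan.intros)
    next
      assume "s \<in> triple_span G v P"
      then show ?thesis unfolding triple_span_def
      proof induction
        case (span_base s)
        then obtain a b where "a \<in> G" "b \<in> P" "s = a * v * b" by blast
        then show ?case using cl[OF Pm] by (simp add: act_mult)
      qed (auto simp: act_zero_left act_add_left act_neg_left intro: addspan.intros)
    qed
  qed (auto simp: act_zero_left act_add_left act_neg_left intro: addspan.intros)
  ultimately show ?case by blast
qed

text \<open>The previous lemma, applied to all multiples \<open>b m\<close>, puts \<open>V m\<close>
  into \<open>q V m\<close>. As \<open>V\<close> is finitely generated as a left module, the
  elements \<open>f m\<close> with \<open>f\<close> in \<open>F\<close> satisfy the relations of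
  Nakayama's lemma with \<open>s = 1\<close>.\<close>

lemma triple_span_act_loc_kernel:
  assumes m: "m \<in> prime_torsion act R"
    and q: "prime_ideal_in G q" and R: "\<And>P. P \<in> R \<Longrightarrow> ideal_in G P"
    and triv: "\<And>P. P \<in> R \<Longrightarrow>
      triple_span G v G \<subseteq> addspan (triple_span q v G \<union> triple_span G v P)"
    and F: "finite F" "left_span G F = triple_span G v G"
    and y: "y \<in> triple_span G v G"
  shows "act y m \<in> loc_kernel G act q"
proof -
  have I: "ideal_in G q" using q by (simp add: prime_ideal_in_def)
  then have qG: "a \<in> G" if "a \<in> q" for a using that by (auto simp: ideal_in_def)
  let ?Q = "addspan {act (a * v * b) m | a b. a \<in> q \<and> b \<in> G}"
  have yQ: "act y m \<in> ?Q" if "y \<in> triple_span G v G" for y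
    using that unfolding triple_span_def
  proof induction
    case (span_base s)
    then obtain a b where ab: "a \<in> G" "b \<in> G" "s = a * v * b" by blast
    have bm: "act b m \<in> prime_torsion act R" using prime_torsion_act[OF m ab(2) R] .
    have sub: "z \<in> ?Q" if "z \<in> addspan {act (a * v * c) (act b m) | a c. a \<in> q \<and> c \<in> G}" for z
      using that
    proof induction
      case (span_base s)
      then obtain a c where ac: "a \<in> q" "c \<in> G" "s = act (a * v * c) (act b m)" by blast
      then have "s = act (a * v * (c * b)) m" by (simp add: act_mult)
      then show ?case using ac ab mult_closed by (intro addspan.span_base) blast
    qed (auto intro: addspan.intros)
    have "act v (act b m) \<in> ?Q" by (rule sub[OF act_prime_torsion[OF bm I R triv]])
    then have "act a (act v (act b m)) \<in> ?Q"
      by (rule addspan_act) (use ab I in \<open>auto simp: ideal_in_def\<close>)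
    then show ?case by (simp add: ab act_mult)
  qed (auto simp: act_zero_left act_add_left act_neg_left intro: addspan.intros)
  have rep: "\<exists>c. (\<forall>f. c f \<in> q) \<and> z = (\<Sum>f\<in>F. act (c f) (act f m))" if "z \<in> ?Q" for z
    using that
  proof induction
    case span_zero
    then show ?case using I by (intro exI[of _ "\<lambda>_. 0"]) (simp add: ideal_in_def act_zero_left)
  next
    case (span_base s)
    then obtain a b where ab: "a \<in> q" "b \<in> G" "s = act (a * v * b) m" by blast
    have "1 * v * b \<in> triple_span G v G"
      unfolding triple_span_def using one_closed ab by (intro addspan.span_base) blast
    then obtain c where c: "\<And>f. c f \<in> G" "v * b = (\<Sum>f\<in>F. c f * f)"
      using left_span_repr[of F "v * b"] F by auto
    have "s = act a (act (v * b) m)" by (simp add: ab mult.assoc flip: act_mult)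
    \<comment> \<open>Commutativity puts the factor from \<open>q\<close> on the right, so that
      \<open>c f * a\<close> is in \<open>q\<close> by the form of \<open>ideal_in\<close>.\<close>
    also have "\<dots> = (\<Sum>f\<in>F. act (c f * a) (act f m))"
      unfolding c(2) using commute[OF c(1) qG[OF ab(1)]]
      by (simp add: act_sum_left act_sum_right act_mult)
    finally show ?case using I c ab by (intro exI[of _ "\<lambda>f. c f * a"]) (simp add: ideal_in_def)
  next
    case (span_add a b)
    then obtain c d where "\<forall>f. c f \<in> q" "a = (\<Sum>f\<in>F. act (c f) (act f m))"
      "\<forall>f. d f \<in> q" "b = (\<Sum>f\<in>F. act (d f) (act f m))" by blast
    then show ?case using I
      by (intro exI[of _ "\<lambda>f. c f + d f"]) (simp add: act_add_left sum.distrib ideal_in_def)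
  next
    case (span_neg a)
    then obtain c where "\<forall>f. c f \<in> q" "a = (\<Sum>f\<in>F. act (c f) (act f m))" by blast
    then show ?case using ideal_neg[OF I]
      by (intro exI[of _ "\<lambda>f. - c f"]) (simp add: act_neg_left sum_negf)
  qed
  have FV: "f \<in> triple_span G v G" if "f \<in> F" for f
  proof -
    have "1 * f \<in> left_span G F"
      unfolding left_span_def using that one_closed by (intro addspan.span_base) blast
    then show ?thesis using F by simp
  qed
  have Fm: "\<forall>f\<in>F. act f m \<in> loc_kernel G act q"
  proof (rule nakayama[OF q F(1)], intro ballI)
    fix f assume "f \<in> F"
    then obtain c where c: "\<forall>f. c f \<in> q" "act f m = (\<Sum>f\<in>F. act (c f) (act f m))"
      using rep[OF yQ[OF FV]] by blast
    then have "act 1 (act f m) - (\<Sum>f\<in>F. act (c f) (act f m)) \<in> loc_kernel G act q"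
      using loc_kernel_zero[OF q] by (simp add: act_one)
    then show "\<exists>s\<in>G - q. \<exists>c. (\<forall>f'. c f' \<in> q) \<and>
        act s (act f m) - (\<Sum>f'\<in>F. act (c f') (act f' m)) \<in> loc_kernel G act q"
      using c one_closed prime_one[OF q] by blast
  qed
  obtain c where c: "\<And>f. c f \<in> G" "y = (\<Sum>f\<in>F. c f * f)"
    using left_span_repr[OF F(1), of y] F y by auto
  have "act (c f) (act f m) \<in> loc_kernel G act q" if "f \<in> F" for f
    using loc_kernel_act[OF q _ c(1)] Fm that by blast
  then show ?thesis
    unfolding c(2) act_sum_left act_mult by (rule loc_kernel_sum[OF q])
qed

end

text \<open>Of the chains ending in \<open>p\<close>, the argument only needs that their starting
  points form a set \<open>R\<close> that contains \<open>p\<close> and is closed under adding a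
  link in front.\<close>

lemma (in comm_module) Ass_subset_linked:
  fixes emb :: "'k \<Rightarrow> 'u" and u :: "'i \<Rightarrow> 'u"
  assumes acc: "acc_ideals G"
    and emb: "range emb \<subseteq> G"
    and gen: "subalg_gen emb (G \<union> u ` N) = UNIV"
    and fin: "\<And>v. \<exists>F. finite F \<and> left_span G F = triple_span G v G"
    and cyclic: "\<And>y. \<exists>a. y = act a x"
    and R: "R \<subseteq> Ass G act" and p: "ann_in G act x \<in> R"
    and linked: "\<And>q P k. q \<in> Ass G act \<Longrightarrow> P \<in> R \<Longrightarrow> k \<in> N \<Longrightarrow>
      \<not> triple_span G (u k) G \<subseteq> addspan (triple_span q (u k) G \<union> triple_span G (u k) P) \<Longrightarrow> q \<in> R"
  shows "Ass G act \<subseteq> R"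
proof
  have RI: "\<And>P. P \<in> R \<Longrightarrow> ideal_in G P"
    using R by (auto simp: Ass_def prime_ideal_in_def)
  \<comment> \<open>For \<open>q\<close> outside \<open>R\<close>, the contrapositive of
    \<open>linked\<close> gives \<open>V = q V + V P\<close> for every \<open>P\<close> in
    \<open>R\<close>.\<close>
  have loc: "act y m \<in> loc_kernel G act q"
    if "m \<in> prime_torsion act R" "q \<in> Ass G act" "q \<notin> R" "k \<in> N" "y \<in> triple_span G (u k) G" for m q k y
  proof -
    obtain F where "finite F" "left_span G F = triple_span G (u k) G" using fin by blast
    moreover have "prime_ideal_in G q" using that by (simp add: Ass_def)
    ultimately show ?thesis
      using that linked[of q _ k] RI by (intro triple_span_act_loc_kernel[of m R q "u k" F]) auto
  qed
  have uV: "u k \<in> triple_span G (u k) G" for k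
  proof -
    have "1 * u k * 1 \<in> triple_span G (u k) G"
      unfolding triple_span_def using one_closed by (intro addspan.span_base) blast
    then show ?thesis by simp
  qed
  have u_torsion: "act (u k) m \<in> prime_torsion act R" if m: "m \<in> prime_torsion act R" and k: "k \<in> N" for k m
  proof -
    let ?V = "triple_span G (u k) G"
    have V: "g * y \<in> ?V" if g: "g \<in> G" and y: "y \<in> ?V" for g y
      using y unfolding triple_span_def
    proof induction
      case (span_base s)
      then obtain a b where ab: "a \<in> G" "b \<in> G" "s = a * u k * b" by blast
      then have "g * s = (g * a) * u k * b" by (simp add: mult.assoc)
      then show ?case using mult_closed[OF g ab(1)] ab(2) by (intro addspan.span_base) blast
    qed (auto simp: distrib_left intro: addspan.intros)
    \<comment> \<open>By the torsion criterion it suffices to look at primes \<open>ann w\<close>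
      with \<open>w\<close> in \<open>V m\<close>. If one were outside \<open>R\<close>, then
      \<open>w\<close> would vanish locally at \<open>ann w\<close>, that is, be killed by an
      element outside its own annihilator.\<close>
    have "(\<lambda>y. act y m) ` ?V \<subseteq> prime_torsion act R"
    proof (rule subset_prime_torsion[OF acc])
      fix g w assume "g \<in> G" "w \<in> (\<lambda>y. act y m) ` ?V"
      then show "act g w \<in> (\<lambda>y. act y m) ` ?V" using V by (auto simp flip: act_mult)
    next
      fix w assume w: "w \<in> (\<lambda>y. act y m) ` ?V" and P: "ann_in G act w \<in> Ass G act"
      show "ann_in G act w \<in> R"
      proof (rule ccontr)
        assume "ann_in G act w \<notin> R"
        then have "w \<in> loc_kernel G act (ann_in G act w)" using loc[OF m P _ k] w by blast
        then show False by (auto simp: loc_kernel_def ann_in_def)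
      qed
    qed
    then show ?thesis using uV[of k] by blast
  qed
  have x: "x \<in> prime_torsion act R"
    by (rule prime_torsion.step[OF p]) (auto simp: ann_in_def intro: prime_torsion.zero)
  have "act a m \<in> prime_torsion act R" if "a \<in> subalg_gen emb (G \<union> u ` N)" "m \<in> prime_torsion act R" for a m
    using that
  proof (induction arbitrary: m)
    case (gen_scalar c)
    then show ?case using prime_torsion_act[OF _ _ RI] emb by blast
  next
    case (gen_base s)
    then show ?case using prime_torsion_act[OF _ _ RI] u_torsion by blast
  next
    case (gen_add a b)
    then show ?case using prime_torsion_add[OF _ _ RI] by (simp add: act_add_left)
  next
    case (gen_mult a b)
    then show ?case by (simp add: act_mult)
  qed
  then have torsion: "m \<in> prime_torsion act R" for m
    using x cyclic[of m] gen by auto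
  fix q assume q: "q \<in> Ass G act"
  show "q \<in> R"
  proof (rule ccontr)
    assume qR: "q \<notin> R"
    have qp: "prime_ideal_in G q" using q by (simp add: Ass_def)
    \<comment> \<open>Locally at \<open>q\<close> the generators \<open>u k\<close> act as zero, so
      each \<open>a\<close> acts on each \<open>m\<close> like some \<open>g\<close> in
      \<open>G\<close>, which may depend on \<open>m\<close>.\<close>
    have "\<exists>g\<in>G. act a m - act g m \<in> loc_kernel G act q" if "a \<in> subalg_gen emb (G \<union> u ` N)" for a m
      using that
    proof (induction arbitrary: m)
      case (gen_scalar c)
      then show ?case using emb loc_kernel_zero[OF qp] by (intro bexI[of _ "emb c"]) auto
    next
      case (gen_base s)
      then show ?case
      proof
        assume "s \<in> G"
        then show ?thesis using loc_kernel_zero[OF qp] by (intro bexI[of _ s]) auto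
      next
        assume "s \<in> u ` N"
        then have "act s m \<in> loc_kernel G act q" using loc[OF torsion q qR _ uV] by blast
        then show ?thesis using zero_closed by (intro bexI[of _ 0]) (auto simp: act_zero_left)
      qed
    next
      case (gen_add a b)
      then obtain g h where gh: "g \<in> G" "act a m - act g m \<in> loc_kernel G act q"
        "h \<in> G" "act b m - act h m \<in> loc_kernel G act q" by metis
      have "act (a + b) m - act (g + h) m = (act a m - act g m) + (act b m - act h m)"
        by (simp add: act_add_left)
      also have "\<dots> \<in> loc_kernel G act q" using gh by (intro loc_kernel_add[OF qp])
      finally show ?case using gh add_closed by blast
    next
      case (gen_mult a b)
      obtain g where g: "g \<in> G" "act a (act b m) - act g (act b m) \<in> loc_kernel G act q"
        using gen_mult.IH(1) by blast
      obtain h where h: "h \<in> G" "act b m - act h m \<in> loc_kernel G act q"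
        using gen_mult.IH(2) by blast
      \<comment> \<open>Here \<open>g\<close> is chosen for the vector \<open>act b m\<close>; the
        error left by \<open>h\<close> is then only multiplied by \<open>g\<close>, which preserves
        the kernel.\<close>
      have "act (a * b) m - act (g * h) m =
          (act a (act b m) - act g (act b m)) + act g (act b m - act h m)"
        by (simp add: act_mult act_diff_right)
      also have "\<dots> \<in> loc_kernel G act q"
        using g h by (intro loc_kernel_add[OF qp] loc_kernel_act[OF qp])
      finally show ?case using g h mult_closed by blast
    qed
    then have span: "\<exists>g\<in>G. act a m - act g m \<in> loc_kernel G act q" for a m using gen by blast
    obtain y where y: "q = ann_in G act y" using q by (auto simp: Ass_def)
    obtain a where "y = act a x" using cyclic by blast
    then obtain g where g: "g \<in> G" "y - act g x \<in> loc_kernel G act q" using span by metis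
    then obtain s where s: "s \<in> G - q" "act s (y - act g x) = 0" by (auto simp: loc_kernel_def)
    then have sy: "act s y = act (s * g) x" by (simp add: act_diff_right act_mult)
    have pp: "prime_ideal_in G (ann_in G act x)" using p R by (auto simp: Ass_def)
    have sg: "s * g \<in> G" using s g mult_closed by blast
    have "act s y \<noteq> 0" using s y by (auto simp: ann_in_def)
    then have sgp: "s * g \<notin> ann_in G act x" using sy by (simp add: ann_in_def)
    \<comment> \<open>The vector \<open>s y = (s g) x\<close> has annihilator \<open>q\<close>,
      since \<open>s\<close> is outside \<open>q\<close>, and also \<open>p\<close>, since
      \<open>s g\<close> is outside the prime \<open>p\<close>.\<close>
    have "h \<in> q \<longleftrightarrow> h \<in> ann_in G act x" if h: "h \<in> G" for h
    proof -
      have "h \<in> q \<longleftrightarrow> h * s \<in> q"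
      proof
        assume "h \<in> q"
        then have "s * h \<in> q" using qp s by (simp add: prime_ideal_in_def ideal_in_def)
        then show "h * s \<in> q" using commute[OF h] s by simp
      next
        assume "h * s \<in> q"
        then show "h \<in> q" using qp h s by (auto simp: prime_ideal_in_def)
      qed
      also have "\<dots> \<longleftrightarrow> act h (act s y) = 0"
        using h s mult_closed by (auto simp: y ann_in_def act_mult)
      also have "\<dots> \<longleftrightarrow> h * (s * g) \<in> ann_in G act x"
        using h sg mult_closed by (auto simp: sy ann_in_def act_mult)
      also have "\<dots> \<longleftrightarrow> h \<in> ann_in G act x"
      proof
        assume "h * (s * g) \<in> ann_in G act x"
        then show "h \<in> ann_in G act x" using pp h sg sgp unfolding prime_ideal_in_def by blast
      next
        assume "h \<in> ann_in G act x"
        then have "(s * g) * h \<in> ann_in G act x"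
          using pp sg by (simp add: prime_ideal_in_def ideal_in_def)
        then show "h * (s * g) \<in> ann_in G act x" using commute[OF h sg] by simp
      qed
      finally show ?thesis .
    qed
    moreover have "q \<subseteq> G" by (auto simp: y ann_in_def)
    ultimately have "q = ann_in G act x" by (auto simp: ann_in_def)
    then show False using qR p by simp
  qed
qed

section \<open>Chains of linked associated primes\<close>

theorem theoremB:
  fixes emb :: "'k::field_char_0 \<Rightarrow> 'u::ring_1"
    and G :: "'u set"
    and u :: "nat \<Rightarrow> 'u"
    and n :: nat
    and act :: "'u \<Rightarrow> 'm::ab_group_add \<Rightarrow> 'm"
    and x :: 'm
    and p q :: "'u set"
  assumes K_closed: "alg_closed TYPE('k)"
    and U_alg: "is_K_algebra emb"
    and G_sub: "comm_subalgebra emb G"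
    and G_fg: "\<exists>S. finite S \<and> S \<subseteq> G \<and> subalg_gen emb S = G"
    and U_gen: "subalg_gen emb (G \<union> u ` {1..n}) = UNIV"
    and fin_bimod: "\<And>v. (\<exists>F. finite F \<and> left_span G F = triple_span G v G) \<and>
                         (\<exists>F. finite F \<and> right_span G F = triple_span G v G)"
    and M_mod: "is_module act"
    and cyclic: "\<forall>y. \<exists>a. y = act a x"
    and p_ann: "ann_in G act x = p"
    and p_prime: "prime_ideal_in G p"
    and same_coht: "\<forall>q1\<in>Ass G act. \<forall>q2\<in>Ass G act. coheight G q1 = coheight G q2"
    and q_Ass: "q \<in> Ass G act"
  shows "\<exists>(s::nat) (qs :: nat \<Rightarrow> 'u set) (ks :: nat \<Rightarrow> nat).
           qs 0 = q \<and> qs s = p \<and>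
           (\<forall>i\<le>s. prime_ideal_in G (qs i) \<and> coheight G (qs i) = coheight G p) \<and>
           (\<forall>i\<in>{1..s}. ks i \<in> {1..n} \<and>
              \<not> triple_span G (u (ks i)) G \<subseteq>
                  addspan (triple_span (qs (i - 1)) (u (ks i)) G \<union> triple_span G (u (ks i)) (qs i)))"
proof -
  interpret comm_module G act
    using comm_subring_subalgebra[OF U_alg G_sub] M_mod by (simp add: comm_module_def comm_module_axioms_def)
  have acc: "acc_ideals G"
    using G_fg acc_ideals_subalg_gen[OF U_alg G_sub] by metis
  \<comment> \<open>For ideals \<open>q1\<close> and \<open>q2\<close> of \<open>G\<close> the
    denominator lies in the numerator, so the quotient is nonzero exactly when the reverse inclusion
    fails.\<close>
  define link where "link k q1 q2 \<longleftrightarrow> k \<in> {1..n} \<and>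
    \<not> triple_span G (u k) G \<subseteq> addspan (triple_span q1 (u k) G \<union> triple_span G (u k) q2)" for k q1 q2
  \<comment> \<open>Both ends are required to be associated primes, so that \<open>same_coht\<close>
    applies to every member of a path.\<close>
  define r where "r q1 q2 \<longleftrightarrow> q1 \<in> Ass G act \<and> q2 \<in> Ass G act \<and> (\<exists>k. link k q1 q2)" for q1 q2
  have p: "p \<in> Ass G act" using p_prime p_ann by (auto simp: Ass_def)
  have "Ass G act \<subseteq> {q \<in> Ass G act. r\<^sup>*\<^sup>* q p}"
  proof (rule Ass_subset_linked[OF acc _ U_gen])
    show "range emb \<subseteq> G" using G_sub by (simp add: comm_subalgebra_def)
    show "\<exists>a. y = act a x" for y using cyclic by blast
    show "\<exists>F. finite F \<and> left_span G F = triple_span G v G" for v using fin_bimod by blast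
    show "ann_in G act x \<in> {q \<in> Ass G act. r\<^sup>*\<^sup>* q p}" using p p_ann by simp
    fix q P k
    assume "q \<in> Ass G act" "P \<in> {q \<in> Ass G act. r\<^sup>*\<^sup>* q p}" "k \<in> {1..n}"
      "\<not> triple_span G (u k) G \<subseteq> addspan (triple_span q (u k) G \<union> triple_span G (u k) P)"
    then have "r q P" "r\<^sup>*\<^sup>* P p" "q \<in> Ass G act" by (auto simp: r_def link_def)
    then show "q \<in> {q \<in> Ass G act. r\<^sup>*\<^sup>* q p}" by (auto intro: converse_rtranclp_into_rtranclp)
  qed blast
  then have "r\<^sup>*\<^sup>* q p" using q_Ass by blast
  then obtain s qs where qs: "qs 0 = q" "qs s = p" "\<And>i. i < s \<Longrightarrow> r (qs i) (qs (Suc i))"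
    unfolding rtranclp_power relpowp_fun_conv by blast
  then obtain ks where ks: "\<And>i. i < s \<Longrightarrow> link (ks i) (qs i) (qs (Suc i))"
    unfolding r_def by metis
  \<comment> \<open>No edge leaves the last vertex; there \<open>qs s = p\<close> is used, which
    also covers a path of length zero.\<close>
  have Ass: "qs i \<in> Ass G act" if "i \<le> s" for i
    using that qs(2,3) p by (cases "i < s") (auto simp: r_def)
  show ?thesis
  \<comment> \<open>Edges are numbered from 0 in \<open>ks\<close> and from 1 in the statement,
    hence the shift to \<open>ks (i - 1)\<close>.\<close>
  proof (intro exI[of _ s] exI[of _ qs] exI[of _ "\<lambda>i. ks (i - 1)"] conjI allI impI ballI)
    fix i assume "i \<le> s"
    then show "prime_ideal_in G (qs i)" using Ass by (simp add: Ass_def)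
    show "coheight G (qs i) = coheight G p" using same_coht Ass[OF \<open>i \<le> s\<close>] p by blast
  next
    fix i assume i: "i \<in> {1..s}"
    then have "link (ks (i - 1)) (qs (i - 1)) (qs i)" using ks[of "i - 1"] by auto
    then show "ks (i - 1) \<in> {1..n}"
      "\<not> triple_span G (u (ks (i - 1))) G \<subseteq>
        addspan (triple_span (qs (i - 1)) (u (ks (i - 1))) G \<union> triple_span G (u (ks (i - 1))) (qs i))"
      by (simp_all add: link_def)
  qed (use qs in auto)
qed

end
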